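(* For every integer $n\geqslant 0$, the number of partitions of $n$ with no parts equal to $1$ equals $\nabla[p](n)=p(n)-p(n-1)$, and $$\nabla [p](n) = -\sum_{k=3}^{n+3} S^{(3)}_{n+3,k}\, \mu(k).$$
   Context: $p(m)$ denotes the number of partitions of the integer $m$, with $p(0)=1$ and $p(m)=0$ for $m<0$. The $N$th order backward difference of a function $f$ is $\nabla^N[f](x)=\sum_{k=0}^N(-1)^k\binom{N}{k}f(x-k)$, and $\nabla=\nabla^1$. $\mu$ is the classical Möbius function on positive integers: $\mu(m)=0$ if $m$ is divisible by the square of a prime, and $\mu(m)=(-1)^s$ if $m$ is a product of $s\geqslant 0$ distinct primes. For integers $r\geqslant 1$, $k\geqslant 1$, $m\geqslant 0$, $S^{(r)}_{m,k}$ denotes the number of $k$'s in the partitions of $m$ with smallest part at least $r$, i.e. the total number of occurrences (with multiplicity) of the part $k$ summed over all partitions of $m$ all of whose parts are $\geqslant r$. *)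

theory Defs
  imports "HOL-Library.Multiset" "HOL-Computational_Algebra.Primes"
begin

definition partitions :: "nat \<Rightarrow> nat multiset set" where
  "partitions m = {M. (\<forall>i\<in>#M. i \<ge> 1) \<and> sum_mset M = m}"

definition num_partitions :: "int \<Rightarrow> int" where
  "num_partitions m = (if m < 0 then 0 else int (card (partitions (nat m))))"

definition backward_diff :: "nat \<Rightarrow> (int \<Rightarrow> int) \<Rightarrow> int \<Rightarrow> int" where
  "backward_diff N f x = (\<Sum>k=0..N. (-1) ^ k * int (N choose k) * f (x - int k))"

definition moebius_mu :: "nat \<Rightarrow> int" where
  "moebius_mu m =
    (if \<exists>q. prime q \<and> q ^ 2 dvd m then 0 else (-1) ^ card {q. prime q \<and> q dvd m})"

text \<open>The number of occurrences, with multiplicity, of the part \<open>k\<close> in all partitions of \<open>m\<close>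
  whose parts are all at least \<open>r\<close> (the empty partition of \<open>0\<close> is included for every \<open>r\<close>).\<close>

definition occurrences :: "nat \<Rightarrow> nat \<Rightarrow> nat \<Rightarrow> nat" where
  "occurrences r m k = (\<Sum>M\<in>{M \<in> partitions m. \<forall>i\<in>#M. i \<ge> r}. count M k)"

text \<open>Finiteness ensures that the cardinalities and sums over partitions are genuine.\<close>

lemma finite_partitions: "finite (partitions m)"
proof (rule finite_subset)
  show "partitions m \<subseteq> mset ` {xs. set xs \<subseteq> {..m} \<and> length xs \<le> m}"
  proof
    fix M assume M: "M \<in> partitions m"
    obtain xs where xs: "M = mset xs" by (metis ex_mset)
    have pos: "\<forall>i\<in>set xs. i \<ge> 1" and sum: "sum_list xs = m"
      using M xs by (auto simp: partitions_def sum_mset_sum_list)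
    have "length xs \<le> sum_list xs"
      using pos by (induction xs) auto
    moreover have "i \<le> m" if "i \<in> set xs" for i
      using member_le_sum_list[OF that] sum by simp
    ultimately show "M \<in> mset ` {xs. set xs \<subseteq> {..m} \<and> length xs \<le> m}"
      using xs sum by auto
  qed
  show "finite (mset ` {xs. set xs \<subseteq> {..m} \<and> length xs \<le> m})"
    by (intro finite_imageI finite_lists_length_le) simp
qed

lemma num_partitions_0: "num_partitions 0 = 1"
proof -
  have "M = {#}" if "\<forall>i\<in>#M. i \<ge> 1" "sum_mset M = 0" for M :: "nat multiset"
    using that by (cases M) auto
  then have "partitions 0 = {{#}}"
    by (auto simp: partitions_def)
  then show ?thesis
    by (simp add: num_partitions_def)
qed

end

theory Submission
  imports Defs
begin

text \<open>Grouping the occurrences of \<open>k\<close> in partitions of \<open>m\<close> by the multiple \<open>d = j k\<close> that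
  \<open>j\<close> copies of \<open>k\<close> take up turns the right-hand side into a sum over \<open>d\<close> of the number of
  partitions of \<open>n + 3 - d\<close> into parts at least 3, weighted by the sum of \<open>\<mu>(k)\<close> over the
  divisors \<open>k \<ge> 3\<close> of \<open>d\<close>. Since the full divisor sum of \<open>\<mu>\<close> vanishes for \<open>d > 1\<close>, that weight
  is \<open>-1\<close> for odd \<open>d \<ge> 3\<close> and 0 otherwise. With \<open>d = e + 3\<close>, what is left is the sum over even
  \<open>e\<close> of the number of partitions of \<open>n - e\<close> into parts at least 3; taking \<open>e / 2\<close> as the number
  of twos, this counts the partitions of \<open>n\<close> into parts at least 2.\<close>

section \<open>Divisor sums of the Moebius function\<close>

lemma moebius_mu_prime_mult:
  assumes p: "prime p" and k: "k > 0" and pk: "\<not> p dvd k"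
  shows "moebius_mu (p * k) = - moebius_mu k"
proof -
  \<comment> \<open>For \<open>q = p\<close> both sides fail, since \<open>p\<close> does not divide
    \<open>k\<close>; any other \<open>q ^ 2\<close> is coprime to \<open>p\<close>.\<close>
  have sq: "q ^ 2 dvd p * k \<longleftrightarrow> q ^ 2 dvd k" if q: "prime q" for q
  proof (cases "q = p")
    case True
    then show ?thesis
      using p pk by (auto simp: power2_eq_square dest: dvd_mult_left)
  next
    case False
    then have "coprime (q ^ 2) p"
      using p q by (simp add: primes_coprime)
    then show ?thesis
      by (simp add: coprime_dvd_mult_right_iff)
  qed
  have "{q. prime q \<and> q dvd p * k} = insert p {q. prime q \<and> q dvd k}"
    using p by (auto simp: prime_dvd_mult_iff primes_dvd_imp_eq)
  moreover have "finite {q. prime q \<and> q dvd k}"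
    using k by (auto intro: finite_subset[OF _ finite_divisors_nat])
  ultimately have "card {q. prime q \<and> q dvd p * k} = Suc (card {q. prime q \<and> q dvd k})"
    using pk by simp
  then show ?thesis
    using sq by (auto simp: moebius_mu_def)
qed

lemma moebius_mu_1: "moebius_mu 1 = 1"
proof -
  have "{q :: nat. prime q \<and> q dvd 1} = {}"
    by (auto simp: prime_nat_iff)
  moreover have "\<not> (\<exists>q :: nat. prime q \<and> q ^ 2 dvd 1)"
    by (auto simp: prime_nat_iff)
  ultimately show ?thesis
    by (simp only: moebius_mu_def if_False card.empty power_0)
qed

lemma moebius_mu_2: "moebius_mu 2 = -1"
proof -
  have "\<not> (2::nat) dvd 1"
    by simp
  then show ?thesis
    using moebius_mu_prime_mult[of 2 1] moebius_mu_1 by simp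
qed

text \<open>Fix a prime \<open>p\<close> dividing \<open>d\<close>. Each divisor \<open>k\<close>
  not divisible by \<open>p\<close> pairs with \<open>p * k\<close>, and the two values cancel.
  Every remaining divisor is a multiple of the square of \<open>p\<close>, where
  \<open>moebius_mu\<close> vanishes.\<close>

lemma sum_moebius_mu_divisors:
  assumes d: "d > 0"
  shows "(\<Sum>k | k dvd d. moebius_mu k) = (if d = 1 then 1 else 0)"
proof (cases "d = 1")
  case True
  then have "{k. k dvd d} = {1}"
    by auto
  then show ?thesis
    using True moebius_mu_1 by simp
next
  case False
  then obtain p where p: "prime p" "p dvd d"
    using prime_factor_nat by blast
  define A where "A = {k. k dvd d \<and> \<not> p dvd k}"
  have fin: "finite {k. k dvd d}"
    using d by (simp add: finite_divisors_nat)
  then have finA: "finite A"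
    unfolding A_def by (rule rev_finite_subset) auto
  have pos: "k > 0" if "k \<in> A" for k
    using that d by (auto simp: A_def intro: Nat.gr0I)
  have sub: "A \<union> (*) p ` A \<subseteq> {k. k dvd d}"
    using p by (auto simp: A_def intro: divides_mult prime_imp_coprime)
  have rest: "moebius_mu k = 0" if k: "k \<in> {k. k dvd d} - (A \<union> (*) p ` A)" for k
  proof -
    from k obtain c where c: "k = p * c"
      by (auto simp: A_def)
    with k have "c dvd d"
      by (auto dest: dvd_mult_right)
    with k c have "p dvd c"
      by (auto simp: A_def)
    then show ?thesis
      using c p by (auto simp: moebius_mu_def power2_eq_square)
  qed
  have "(\<Sum>k | k dvd d. moebius_mu k) = (\<Sum>k\<in>A \<union> (*) p ` A. moebius_mu k)"
    using fin sub rest by (intro sum.mono_neutral_right) auto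
  also have "\<dots> = (\<Sum>k\<in>A. moebius_mu k) + (\<Sum>k\<in>(*) p ` A. moebius_mu k)"
    using finA by (intro sum.union_disjoint) (auto simp: A_def)
  also have "(\<Sum>k\<in>(*) p ` A. moebius_mu k) = (\<Sum>k\<in>A. moebius_mu (p * k))"
    using p by (subst sum.reindex) (auto simp: inj_on_def)
  also have "\<dots> = (\<Sum>k\<in>A. - moebius_mu k)"
    using p pos by (intro sum.cong) (auto simp: A_def intro: moebius_mu_prime_mult)
  finally show ?thesis
    using False by (simp add: sum_negf)
qed

text \<open>The divisors below 3 contribute 1 for odd \<open>d\<close>, and 1 - 1 = 0 for even
  \<open>d\<close>. Subtracting this from the full divisor sum leaves -1 for odd \<open>d\<close>,
  except at \<open>d = 1\<close>, where the full sum is itself 1.\<close>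

lemma sum_moebius_mu_divisors_ge_3:
  assumes d: "d > 0"
  shows "(\<Sum>k | k dvd d \<and> k \<ge> 3. moebius_mu k) = (if odd d \<and> d \<ge> 3 then -1 else 0)"
proof -
  have fin: "finite {k. k dvd d}"
    using d by (simp add: finite_divisors_nat)
  have "(\<Sum>k | k dvd d. moebius_mu k) =
      (\<Sum>k\<in>{k. k dvd d \<and> k \<ge> 3} \<union> {k. k dvd d \<and> k < 3}. moebius_mu k)"
    by (intro sum.cong) auto
  also have "\<dots> =
      (\<Sum>k | k dvd d \<and> k \<ge> 3. moebius_mu k) + (\<Sum>k | k dvd d \<and> k < 3. moebius_mu k)"
    using fin by (intro sum.union_disjoint) auto
  finally have "(\<Sum>k | k dvd d. moebius_mu k) =
      (\<Sum>k | k dvd d \<and> k \<ge> 3. moebius_mu k) + (\<Sum>k | k dvd d \<and> k < 3. moebius_mu k)" .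
  moreover have "{k. k dvd d \<and> k < 3} = (if even d then {1, 2} else {1})"
  proof -
    have "k dvd d \<and> k < 3 \<longleftrightarrow> k = 1 \<or> even d \<and> k = 2" for k
    proof -
      consider "k = 0" | "k = 1" | "k = 2" | "k \<ge> 3"
        by linarith
      then show ?thesis
        using d by cases simp_all
    qed
    then show ?thesis
      by auto
  qed
  then have "(\<Sum>k | k dvd d \<and> k < 3. moebius_mu k) = (if even d then 0 else 1)"
    using moebius_mu_1 moebius_mu_2 by simp
  ultimately have "(\<Sum>k | k dvd d \<and> k \<ge> 3. moebius_mu k) =
      (if d = 1 then 1 else 0) - (if even d then 0 else 1)"
    using sum_moebius_mu_divisors[OF d] by linarith
  moreover have "odd d \<and> d \<ge> 3 \<longleftrightarrow> odd d \<and> d \<noteq> 1"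
  proof -
    consider "d = 1" | "d = 2" | "d \<ge> 3"
      using d by linarith
    then show ?thesis
      by cases simp_all
  qed
  ultimately show ?thesis
    by (cases "even d"; cases "d = 1") simp_all
qed

section \<open>Partitions with a lower bound on the parts\<close>

definition partitions_ge :: "nat \<Rightarrow> nat \<Rightarrow> nat multiset set" where
  "partitions_ge r m = {M \<in> partitions m. \<forall>i\<in>#M. i \<ge> r}"

lemma finite_partitions_ge [simp]: "finite (partitions_ge r m)"
  by (simp add: partitions_ge_def finite_partitions)

lemma mult_count_le_sum_mset: "count M k * k \<le> sum_mset (M :: nat multiset)"
proof -
  have "replicate_mset (count M k) k \<subseteq># M"
    by (simp flip: count_le_replicate_mset_subset_eq)
  then obtain N where "M = replicate_mset (count M k) k + N"
    by (auto simp: mset_subset_eq_exists_conv)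
  then have "sum_mset M = sum_mset (replicate_mset (count M k) k + N)"
    by (rule arg_cong)
  then show ?thesis
    by simp
qed

text \<open>Removing \<open>j\<close> copies of \<open>k\<close> undoes adding them. The bound
  \<open>r \<le> k\<close> keeps the enlarged multiset admissible, and \<open>j * k \<le> m\<close>
  keeps the subtraction from truncating.\<close>

lemma partitions_ge_count_ge:
  assumes "1 \<le> k" "r \<le> k" "j * k \<le> m"
  shows "{M \<in> partitions_ge r m. j \<le> count M k} =
    (\<lambda>M. replicate_mset j k + M) ` partitions_ge r (m - j * k)" (is "?L = ?R")
proof
  show "?R \<subseteq> ?L"
    using assms by (auto simp: partitions_ge_def partitions_def split: if_splits)
next
  show "?L \<subseteq> ?R"
  proof
    fix M assume M: "M \<in> ?L"
    then have "replicate_mset j k \<subseteq># M"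
      by (simp add: count_le_replicate_mset_subset_eq)
    then obtain N where N: "M = replicate_mset j k + N"
      by (auto simp: mset_subset_eq_exists_conv)
    with M have "N \<in> partitions_ge r (m - j * k)"
      by (auto simp: partitions_ge_def partitions_def)
    with N show "M \<in> ?R"
      by auto
  qed
qed

lemma card_partitions_ge_count_ge:
  assumes "1 \<le> k" "r \<le> k" "j * k \<le> m"
  shows "card {M \<in> partitions_ge r m. j \<le> count M k} = card (partitions_ge r (m - j * k))"
  by (simp add: partitions_ge_count_ge[OF assms] card_image inj_on_def)

text \<open>Split by whether \<open>r\<close> occurs; if it does, remove one copy. When
  \<open>r > m\<close>, the truncated \<open>m - r\<close> would be 0 and wrongly count the empty
  partition, hence the case distinction. The case \<open>r = 1\<close> yields the backward
  difference, and \<open>r = 2\<close> peels off twos one at a time.\<close>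

lemma card_partitions_ge_rec:
  assumes r: "r \<ge> 1"
  shows "card (partitions_ge r m) =
    card (partitions_ge (Suc r) m) + (if r \<le> m then card (partitions_ge r (m - r)) else 0)"
proof -
  have "Suc r \<le> i \<longleftrightarrow> r \<le> i \<and> i \<noteq> r" for i
    by auto
  then have eq: "partitions_ge r m =
      partitions_ge (Suc r) m \<union> {M \<in> partitions_ge r m. 1 \<le> count M r}"
    by (auto simp: partitions_ge_def)
  have "card (partitions_ge r m) =
      card (partitions_ge (Suc r) m) + card {M \<in> partitions_ge r m. 1 \<le> count M r}"
    by (subst eq, intro card_Un_disjoint)
      (auto simp: partitions_ge_def Suc_le_eq count_greater_zero_iff finite_partitions)
  moreover have "card {M \<in> partitions_ge r m. 1 \<le> count M r} = card (partitions_ge r (m - r))"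
    if "r \<le> m"
    using card_partitions_ge_count_ge[of r r 1 m] r that by simp
  moreover have "{M \<in> partitions_ge r m. 1 \<le> count M r} = {}" if "\<not> r \<le> m"
  proof -
    have False if M: "M \<in> partitions_ge r m" "1 \<le> count M r" for M
    proof -
      have "r \<le> count M r * r"
        using M by simp
      also have "\<dots> \<le> m"
        using mult_count_le_sum_mset[of M r] M by (simp add: partitions_ge_def partitions_def)
      finally show False
        using \<open>\<not> r \<le> m\<close> by simp
    qed
    then show ?thesis
      by auto
  qed
  ultimately show ?thesis
    by (cases "r \<le> m") simp_all
qed

lemma card_partitions_ge_2:
  "card (partitions_ge 2 n) = (\<Sum>e | e \<le> n \<and> even e. card (partitions_ge 3 (n - e)))"
proof (induction n rule: less_induct)
  case (less n)
  note rec = card_partitions_ge_rec[of 2 n, simplified]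
  show ?case
  proof (cases "2 \<le> n")
    case False
    then have "e \<le> n \<and> even e \<longleftrightarrow> e = 0" for e
      by (cases "e = 1") auto
    with False rec show ?thesis
      by (simp add: numeral_3_eq_3)
  next
    case True
    \<comment> \<open>Here \<open>e\<close> is the total taken up by twos: \<open>e = 0\<close>
      matches the partitions without a two, and the other indices, shifted by 2, match the induction
      hypothesis for \<open>n - 2\<close>.\<close>
    have "e \<le> n \<and> even e \<longleftrightarrow> e = 0 \<or> (\<exists>f. e = f + 2 \<and> f \<le> n - 2 \<and> even f)" for e
    proof (cases "e < 2")
      case True
      then show ?thesis
        using less_2_cases by fastforce
    next
      case False
      then show ?thesis
        using True by (auto intro!: exI[of _ "e - 2"])
    qed
    then have "{e. e \<le> n \<and> even e} = insert 0 ((\<lambda>f. f + 2) ` {f. f \<le> n - 2 \<and> even f})"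
      by auto
    moreover have "inj_on (\<lambda>f. f + 2) {f. f \<le> n - 2 \<and> even f}"
      by (simp add: inj_on_def)
    ultimately have "(\<Sum>e | e \<le> n \<and> even e. card (partitions_ge 3 (n - e))) =
        card (partitions_ge 3 n) + (\<Sum>f | f \<le> n - 2 \<and> even f. card (partitions_ge 3 (n - (f + 2))))"
      by (simp add: sum.reindex image_iff del: add_2_eq_Suc')
    also have "\<dots> = card (partitions_ge 3 n) + card (partitions_ge 2 (n - 2))"
      using less.IH[of "n - 2"] True by (simp add: diff_diff_left add.commute)
    finally show ?thesis
      using rec True by (simp add: numeral_3_eq_3)
  qed
qed

section \<open>Double counting of occurrences\<close>

lemma occurrences_eq_sum_multiples:
  assumes k: "1 \<le> k" "r \<le> k"
  shows "occurrences r m k = (\<Sum>d | d \<in> {1..m} \<and> k dvd d. card (partitions_ge r (m - d)))"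
proof -
  define J where "J = {j. 1 \<le> j \<and> j * k \<le> m}"
  have "J \<subseteq> {..m}"
  proof
    fix j assume "j \<in> J"
    moreover have "j \<le> j * k"
      using k by simp
    ultimately show "j \<in> {..m}"
      unfolding J_def using order_trans by blast
  qed
  then have finJ: "finite J"
    by (rule finite_subset) simp
  \<comment> \<open>Writing a multiplicity as the number of thresholds \<open>j\<close> that it
    reaches lets the sums be swapped, so that each \<open>j\<close> counts the partitions with at
    least \<open>j\<close> copies of \<open>k\<close>. The bound \<open>j * k \<le> m\<close> in
    \<open>J\<close> discards no such threshold.\<close>
  have count: "count M k = (\<Sum>j\<in>J. if j \<le> count M k then 1 else 0)"
    if M: "M \<in> partitions_ge r m" for M
  proof -
    have "j * k \<le> m" if "j \<le> count M k" for j
    proof -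
      have "j * k \<le> count M k * k"
        using that by (rule mult_le_mono1)
      also have "\<dots> \<le> m"
        using mult_count_le_sum_mset[of M k] M by (simp add: partitions_ge_def partitions_def)
      finally show ?thesis .
    qed
    then have "{j \<in> J. j \<le> count M k} = {1..count M k}"
      by (auto simp: J_def)
    then show ?thesis
      using finJ by (simp add: sum.If_cases Int_def)
  qed
  have "occurrences r m k = (\<Sum>M\<in>partitions_ge r m. \<Sum>j\<in>J. if j \<le> count M k then 1 else 0)"
    unfolding occurrences_def partitions_ge_def[symmetric] by (intro sum.cong count refl)
  also have "\<dots> = (\<Sum>j\<in>J. \<Sum>M\<in>partitions_ge r m. if j \<le> count M k then 1 else 0)"
    by (rule sum.swap)
  also have "\<dots> = (\<Sum>j\<in>J. card (partitions_ge r (m - j * k)))"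
    using k by (intro sum.cong)
      (auto simp: J_def sum.If_cases Int_def card_partitions_ge_count_ge[symmetric])
  also have "\<dots> = (\<Sum>d\<in>(\<lambda>j. j * k) ` J. card (partitions_ge r (m - d)))"
    using k by (subst sum.reindex) (auto simp: inj_on_def)
  also have "(\<lambda>j. j * k) ` J = {d \<in> {1..m}. k dvd d}"
    using k by (auto simp: J_def image_iff Suc_le_eq mult.commute elim!: dvdE)
  finally show ?thesis
    by simp
qed

lemma sum_occurrences_3_moebius_mu:
  "(\<Sum>k=3..n+3. int (occurrences 3 (n + 3) k) * moebius_mu k) = - int (card (partitions_ge 2 n))"
proof -
  define P where "P d = int (card (partitions_ge 3 (n + 3 - d)))" for d
  have "(\<Sum>k=3..n+3. int (occurrences 3 (n + 3) k) * moebius_mu k) =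
      (\<Sum>k=3..n+3. \<Sum>d | d \<in> {1..n+3} \<and> k dvd d. P d * moebius_mu k)"
    by (intro sum.cong) (auto simp: occurrences_eq_sum_multiples P_def sum_distrib_right)
  also have "\<dots> = (\<Sum>d=1..n+3. \<Sum>k | k \<in> {3..n+3} \<and> k dvd d. P d * moebius_mu k)"
    by (rule sum.swap_restrict) auto
  also have "\<dots> = (\<Sum>d=1..n+3. P d * (if odd d \<and> d \<ge> 3 then -1 else 0))"
  proof (intro sum.cong refl)
    fix d assume d: "d \<in> {1..n+3}"
    \<comment> \<open>As \<open>d\<close> is positive and at most \<open>n + 3\<close>, the upper
      bound on its divisors is automatic.\<close>
    then have "{k. k \<in> {3..n+3} \<and> k dvd d} = {k. k dvd d \<and> k \<ge> 3}"
      by (auto dest: dvd_imp_le)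
    then show "(\<Sum>k | k \<in> {3..n+3} \<and> k dvd d. P d * moebius_mu k) =
        P d * (if odd d \<and> d \<ge> 3 then -1 else 0)"
      using d sum_moebius_mu_divisors_ge_3[of d] by (simp flip: sum_distrib_left)
  qed
  \<comment> \<open>Odd \<open>d\<close> from 3 to \<open>n + 3\<close> are exactly
    \<open>e + 3\<close> for even \<open>e \<le> n\<close>, and then
    \<open>n + 3 - d = n - e\<close>.\<close>
  also have "\<dots> = (\<Sum>d\<in>(\<lambda>e. e + 3) ` {e. e \<le> n \<and> even e}. - P d)"
  proof (intro sum.mono_neutral_cong_right)
    have "d \<in> (\<lambda>e. e + 3) ` {e. e \<le> n \<and> even e}" if "odd d" "3 \<le> d" "d \<le> n + 3" for d
      using that by (intro image_eqI[of _ _ "d - 3"]) auto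
    then show "\<forall>d\<in>{1..n+3} - (\<lambda>e. e + 3) ` {e. e \<le> n \<and> even e}.
        P d * (if odd d \<and> d \<ge> 3 then -1 else 0) = 0"
      by auto
  qed auto
  also have "\<dots> = - int (card (partitions_ge 2 n))"
    by (simp add: sum.reindex P_def sum_negf card_partitions_ge_2)
  finally show ?thesis .
qed

theorem corollary1p5:
  fixes n :: nat
  shows "int (card {M \<in> partitions n. 1 \<notin># M}) = backward_diff 1 num_partitions (int n)
    \<and> backward_diff 1 num_partitions (int n) = num_partitions (int n) - num_partitions (int n - 1)
    \<and> backward_diff 1 num_partitions (int n)
        = - (\<Sum>k=3..n+3. int (occurrences 3 (n + 3) k) * moebius_mu k)"
proof -
  have diff: "backward_diff 1 num_partitions (int n) =
      num_partitions (int n) - num_partitions (int n - 1)"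
    by (simp add: backward_diff_def)
  have ge1: "partitions_ge 1 m = partitions m" for m
    by (auto simp: partitions_ge_def partitions_def)
  have "i \<ge> 2 \<longleftrightarrow> i \<ge> 1 \<and> i \<noteq> 1" for i :: nat
    by auto
  then have ge2: "partitions_ge 2 n = {M \<in> partitions n. 1 \<notin># M}"
    by (auto simp: partitions_ge_def partitions_def)
  \<comment> \<open>For \<open>n = 0\<close> the zero branch agrees with the value 0 of
    \<open>num_partitions\<close> at -1.\<close>
  have "card (partitions n) =
      card (partitions_ge 2 n) + (if 1 \<le> n then card (partitions (n - 1)) else 0)"
    using card_partitions_ge_rec[of 1 n] by (simp only: ge1 Suc_1 order_refl)
  then have "int (card (partitions_ge 2 n)) = num_partitions (int n) - num_partitions (int n - 1)"
    by (auto simp: num_partitions_def nat_diff_distrib)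
  then show ?thesis
    using diff sum_occurrences_3_moebius_mu[of n] by (simp add: ge2)
qed

end
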